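(* Let $\mathcal X$ and $\mathcal Y$ be two measurable spaces for which there exist, for some integer $d\ge 1$, two measurable maps $\Phi_{\mathcal X}:\mathcal X\to\mathbb R^d$ and $\Phi_{\mathcal Y}:\mathcal Y\to\mathbb R^d$ that are injective and whose inverses (defined on their images) are measurable. Let $\mu\in\mathcal P(\mathcal X)$ and $\nu\in\mathcal P(\mathcal Y)$ be two probability measures. Let $c:\mathcal X\times\mathcal Y\to\mathbb R$, and let $B_{\mathcal X},B_{\mathcal Y}$ be two measurable spaces along with measurable maps $\varphi:\mathcal X\to B_{\mathcal X}$ and $\psi:\mathcal Y\to B_{\mathcal Y}$. Assume that there exists a cost $\tilde c:B_{\mathcal X}\times B_{\mathcal Y}\to\mathbb R$ such that $$c(x,y)=\tilde c(\varphi(x),\psi(y))\quad\text{for all }(x,y)\in\mathcal X\times\mathcal Y,$$ and that there exists a Monge map $t_B:B_{\mathcal X}\to B_{\mathcal Y}$ between $\varphi_\#\mu$ and $\psi_\#\nu$ for the cost $\tilde c$. Assume that there exists a disintegration $(\mu_u)_{u\in B_{\mathcal X}}$ of $\mu$ with respect to $\varphi$ such that $\mu_u$ is atomless for $\varphi_\#\mu$-a.e. $u$, and that $\nu$ admits a disintegration $(\nu_v)_{v\in B_{\mathcal Y}}$ with respect to $\psi$. Then there exists a Monge map $T:\mathcal X\to\mathcal Y$ between $\mu$ and $\nu$ for the cost $c$. Furthermore, it can be chosen to project onto $t_B$ through $(\varphi,\psi)$, in the sense that $$(\varphi,\psi)_\#(\mathrm{id},T)_\#\mu=(\mathrm{i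d},t_B)_\#(\varphi_\#\mu).$$
   Context: $\mathcal P(\mathcal X)$ is the set of probability measures on $\mathcal X$; $T_\#\mu(A)=\mu(T^{-1}(A))$ is the pushforward; $(\varphi,\psi)$ denotes the map $(x,y)\mapsto(\varphi(x),\psi(y))$. $\Pi(\mu,\nu)$ is the set of probability measures on the product space with marginals $\mu$ and $\nu$. Monge map: a measurable map $T$ with $T_\#\mu=\nu$ such that $(\mathrm{id},T)_\#\mu$ minimizes $\pi\mapsto\int c\,d\pi$ over $\pi\in\Pi(\mu,\nu)$ is called a Monge map (optimal transport map) between $\mu$ and $\nu$ for the cost $c$. Costs are understood to be measurable and such that the integrals $\int c\,d\pi$ are well defined. Disintegration: given $\mu\in\mathcal P(\mathcal X)$ and a measurable $\varphi:\mathcal X\to\mathcal Z$, a family $(\mu_u)_{u\in\mathcal Z}\subset\mathcal P(\mathcal X)$ is a disintegration of $\mu$ with respect to $\varphi$ if (i) $u\mapsto\mu_u$ is measurable (i.e. $u\mapsto\mu_u(A)$ is measurable for each measurable $A$); (ii) $\mu_u(\mathcal X\setminus\varphi^{-1}(u))=0$ for $\varphi_\#\mu$-a.e. $u$; (iii) $\int_{\mathcal X}f\,d\mu=\int_{\mathcal Z}\big(\int_{\varphi^{-1}(u)}f\,d\mu_u\big)\,d(\varphi_\#\mu)(u)$ for every measurable $f:\mathcal X\to[0,\infty]$.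
   Formalization: Measurability of the inverses of the maps Φ is taken to mean that images of measurable sets are Borel in R^d, so the images are Borel; with only the trace σ-algebra on the image the claim fails, e.g. for Y a Bernstein subset of [0,1] with the trace of Lebesgue measure. *)

theory Defs
  imports "HOL-Probability.Probability"
begin

text \<open>
  The inverse is a partially defined map on the Euclidean space with domain
  \<^term>\<open>\<Phi> ` space X\<close>. Its measurability means that preimages of measurable sets are Borel
  sets of the ambient space; in particular the image itself is a Borel set. Measurability with
  respect to the trace \<open>\<sigma>\<close>-algebra on an arbitrary image would not be enough: a Bernstein
  subset of the unit interval, with the trace of Lebesgue measure, is not the image of Lebesgue
  measure under any Borel map.
\<close>
definition bimeasurable_injection :: "'a measure \<Rightarrow> ('a \<Rightarrow> 'e::topological_space) \<Rightarrow> bool" where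
  "bimeasurable_injection X \<Phi> \<longleftrightarrow>
     \<Phi> \<in> X \<rightarrow>\<^sub>M borel \<and> inj_on \<Phi> (space X) \<and>
     (\<forall>A\<in>sets X. the_inv_into (space X) \<Phi> -` A \<inter> \<Phi> ` space X \<in> sets borel)"

definition atomless :: "'a measure \<Rightarrow> bool" where
  "atomless M \<longleftrightarrow>
     (\<forall>A\<in>sets M. 0 < emeasure M A \<longrightarrow>
        (\<exists>B\<in>sets M. B \<subseteq> A \<and> 0 < emeasure M B \<and> emeasure M B < emeasure M A))"

definition couplings :: "'a measure \<Rightarrow> 'b measure \<Rightarrow> ('a \<times> 'b) measure set" where
  "couplings \<mu> \<nu> =
     {\<pi> \<in> space (prob_algebra (\<mu> \<Otimes>\<^sub>M \<nu>)). distr \<pi> \<mu> fst = \<mu> \<and> distr \<pi> \<nu> snd = \<nu>}"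

text \<open>
  The extended integral, positive part minus negative part (\<^const>\<open>ennreal\<close> truncates negative
  reals to \<open>0\<close>). It is meaningful when the two parts are not both infinite.
\<close>
definition integral_defined :: "'a measure \<Rightarrow> ('a \<Rightarrow> real) \<Rightarrow> bool" where
  "integral_defined M f \<longleftrightarrow>
     f \<in> borel_measurable M \<and>
     ((\<integral>\<^sup>+z. ennreal (f z) \<partial>M) < \<infinity> \<or> (\<integral>\<^sup>+z. ennreal (- f z) \<partial>M) < \<infinity>)"

definition ext_integral :: "'a measure \<Rightarrow> ('a \<Rightarrow> real) \<Rightarrow> ereal" where
  "ext_integral M f =
     enn2ereal (\<integral>\<^sup>+z. ennreal (f z) \<partial>M) - enn2ereal (\<integral>\<^sup>+z. ennreal (- f z) \<partial>M)"

definition transport_cost :: "'a measure \<Rightarrow> 'b measure \<Rightarrow> ('a \<times> 'b \<Rightarrow> real) \<Rightarrow> bool" where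
  "transport_cost \<mu> \<nu> c \<longleftrightarrow>
     c \<in> borel_measurable (\<mu> \<Otimes>\<^sub>M \<nu>) \<and> (\<forall>\<pi>\<in>couplings \<mu> \<nu>. integral_defined \<pi> c)"

definition Monge_map ::
  "'a measure \<Rightarrow> 'b measure \<Rightarrow> ('a \<times> 'b \<Rightarrow> real) \<Rightarrow> ('a \<Rightarrow> 'b) \<Rightarrow> bool" where
  "Monge_map \<mu> \<nu> c T \<longleftrightarrow>
     T \<in> \<mu> \<rightarrow>\<^sub>M \<nu> \<and> distr \<mu> \<nu> T = \<nu> \<and>
     is_arg_min (\<lambda>\<pi>. ext_integral \<pi> c) (\<lambda>\<pi>. \<pi> \<in> couplings \<mu> \<nu>)
       (distr \<mu> (\<mu> \<Otimes>\<^sub>M \<nu>) (\<lambda>x. (x, T x)))"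

text \<open>
  The \<open>\<sigma>\<close>-algebra of \<^const>\<open>prob_algebra\<close> is generated by the evaluations at measurable sets,
  so the first conjunct says that every \<open>m u\<close> is a probability measure and that each
  \<open>u \<mapsto> m u A\<close> is measurable.
\<close>
definition disintegration ::
  "'a measure \<Rightarrow> 'u measure \<Rightarrow> ('a \<Rightarrow> 'u) \<Rightarrow> ('u \<Rightarrow> 'a measure) \<Rightarrow> bool" where
  "disintegration \<mu> B \<phi> m \<longleftrightarrow>
     m \<in> B \<rightarrow>\<^sub>M prob_algebra \<mu> \<and>
     (AE u in distr \<mu> B \<phi>. space \<mu> - \<phi> -` {u} \<in> null_sets (m u)) \<and>
     (\<forall>f\<in>borel_measurable \<mu>.
        (\<integral>\<^sup>+x. f x \<partial>\<mu>) = (\<integral>\<^sup>+u. (\<integral>\<^sup>+x\<in>\<phi> -` {u}. f x \<partial>m u) \<partial>distr \<mu> B \<phi>))"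

end

theory Submission
  imports Defs
begin

text \<open>
  On almost every fibre, \<open>\<mu>\<^sub>u\<close> is transported to \<open>\<nu>\<close> disintegrated at \<open>t\<^sub>B u\<close> by the monotone
  rearrangement: both spaces embed in the real line, the distribution function of the atomless
  \<open>\<mu>\<^sub>u\<close> pushes it to the uniform law, and the quantile function of the target pushes the uniform
  law to the target. Distribution and quantile functions are jointly measurable in the base point,
  so the fibre maps glue to one measurable \<open>T\<close>. The law of \<open>(\<phi>, T)\<close> under \<open>\<mu>\<close> is then explicit, and
  yields both \<open>T\<^sub># \<mu> = \<nu>\<close> and the projection onto \<open>t\<^sub>B\<close>. Since a coupling of \<open>\<mu>\<close> and \<open>\<nu>\<close> has the
  same cost as its image under \<open>(\<phi>, \<psi>)\<close>, optimality of \<open>t\<^sub>B\<close> passes to \<open>T\<close>.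
\<close>

section \<open>Euclidean spaces as Borel retracts of the real line\<close>

text \<open>
  Ternary expansions with digits \<open>0\<close> and \<open>2\<close> make decoding Borel on all of \<open>\<real>\<close>. This avoids the
  Lusin-Souslin theorem, which measurability of the inverse of a general Borel injection would need.
\<close>

definition cantor_code :: "(nat \<Rightarrow> bool) \<Rightarrow> real" where
  "cantor_code b = (\<Sum>n. 2 * of_bool (b n) / 3 ^ Suc n)"

text \<open>The expanding map of the Cantor set, which drops the leading ternary digit. The
  threshold 1/2 lies in the middle gap, so on codes it reads that digit, and off the codes the map
  is still Borel.\<close>

definition cantor_shift :: "real \<Rightarrow> real" where
  "cantor_shift t = (if 1/2 \<le> t then 3 * t - 2 else 3 * t)"

definition cantor_digit :: "nat \<Rightarrow> real \<Rightarrow> bool" where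
  "cantor_digit n t \<longleftrightarrow> 1/2 \<le> (cantor_shift ^^ n) t"

lemma sums_two_thirds: "(\<lambda>n. 2 / 3 ^ Suc n :: real) sums 1"
  using sums_mult[OF geometric_sums[of "1/3::real"], of "2/3"] by (simp add: power_divide)

lemma summable_cantor: "summable (\<lambda>n. 2 * of_bool (b n) / 3 ^ Suc n :: real)"
  by (rule summable_comparison_test'[OF sums_summable[OF sums_two_thirds], of 0]) (auto simp: of_bool_def)

lemma cantor_code_bounds: "0 \<le> cantor_code b" "cantor_code b \<le> 1"
proof -
  show "0 \<le> cantor_code b"
    unfolding cantor_code_def by (intro suminf_nonneg summable_cantor) simp
  have "cantor_code b \<le> (\<Sum>n. 2 / 3 ^ Suc n)"
    unfolding cantor_code_def
    by (intro suminf_le summable_cantor sums_summable[OF sums_two_thirds]) (auto simp: of_bool_def)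
  then show "cantor_code b \<le> 1"
    using sums_unique[OF sums_two_thirds] by simp
qed

lemma cantor_code_rec: "cantor_code b = (2 * of_bool (b 0) + cantor_code (\<lambda>n. b (Suc n))) / 3"
proof -
  have "cantor_code (\<lambda>n. b (Suc n)) / 3 = (\<Sum>n. 2 * of_bool (b (Suc n)) / 3 ^ Suc (Suc n))"
    unfolding cantor_code_def
    by (subst suminf_divide[OF summable_cantor, symmetric]) (simp add: field_simps)
  then show ?thesis
    using suminf_split_head[OF summable_cantor, of b] by (simp add: cantor_code_def add_divide_distrib)
qed

text \<open>The tail of an expansion has a code in [0, 1], so the recursion puts the whole code in
  [0, 1/3] or in [2/3, 1] according to the first digit.\<close>

lemma cantor_code_ge_half: "1/2 \<le> cantor_code b \<longleftrightarrow> b 0"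
  using cantor_code_rec[of b] cantor_code_bounds[of "\<lambda>n. b (Suc n)"] by (cases "b 0") auto

lemma cantor_shift_code: "cantor_shift (cantor_code b) = cantor_code (\<lambda>n. b (Suc n))"
  using cantor_code_ge_half[of b] cantor_code_rec[of b] by (auto simp: cantor_shift_def)

text \<open>Shifting \<open>n\<close> times turns digit \<open>n\<close> into the leading digit,
  which the comparison with 1/2 detects.\<close>

lemma cantor_digit_code [simp]: "cantor_digit n (cantor_code b) \<longleftrightarrow> b n"
proof -
  have "(cantor_shift ^^ n) (cantor_code b) = cantor_code (\<lambda>k. b (k + n))"
    by (induction n) (simp_all add: cantor_shift_code)
  then show ?thesis
    using cantor_code_ge_half[of "\<lambda>k. b (k + n)"] by (simp add: cantor_digit_def)
qed

lemma measurable_cantor_code [measurable (raw)]: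
  assumes [measurable]: "\<And>n. Measurable.pred M (\<lambda>x. b x n)"
  shows "(\<lambda>x. cantor_code (b x)) \<in> borel_measurable M"
  unfolding cantor_code_def by measurable

lemma measurable_cantor_digit [measurable]: "Measurable.pred borel (cantor_digit n)"
proof -
  have [measurable]: "cantor_shift \<in> borel_measurable borel"
    unfolding cantor_shift_def[abs_def] by measurable
  have [measurable]: "cantor_shift ^^ n \<in> borel_measurable borel"
    by (induction n) (simp_all add: measurable_comp[where N=borel])
  show ?thesis
    unfolding cantor_digit_def[abs_def] by measurable
qed

text \<open>Density of the rationals; the value -\<infinity> is neutral for the supremum. A real
  coordinate is thus recovered from countably many truth values.\<close>

lemma SUP_rat_below: "(SUP q. if real_of_rat q < x then ereal (real_of_rat q) else -\<infinity>) = ereal x"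
proof (rule SUP_eqI)
  fix y :: ereal
  assume y: "\<And>q. q \<in> UNIV \<Longrightarrow> (if real_of_rat q < x then ereal (real_of_rat q) else -\<infinity>) \<le> y"
  show "ereal x \<le> y"
  proof (rule ccontr)
    assume "\<not> ereal x \<le> y"
    then obtain z where z: "y < ereal z" "z < x"
      by (metis ereal_dense2 less_ereal.simps(1) not_le)
    then obtain q where "z < real_of_rat q" "real_of_rat q < x"
      using of_rat_dense by blast
    then show False
      using y[of q] less_trans[of y "ereal z" "ereal (real_of_rat q)"] z by simp
  qed
qed auto

text \<open>A point is encoded by the truth values of \<open>q < x \<bullet> b\<close> over all
  rationals \<open>q\<close> and basis vectors \<open>b\<close>, enumerated as one Boolean sequence.
  Decoding takes, for each \<open>b\<close>, the supremum of the rationals marked true.\<close>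

lemma euclidean_space_borel_retract:
  obtains j :: "'a::euclidean_space \<Rightarrow> real" and k :: "real \<Rightarrow> 'a"
  where "j \<in> borel_measurable borel" "k \<in> borel_measurable borel" "\<And>x. k (j x) = x"
proof
  let ?q = "\<lambda>n. real_of_rat (from_nat n)"
  let ?j = "\<lambda>x::'a. cantor_code (\<lambda>p.
      ?q (snd (prod_decode p)) < x \<bullet> from_nat_into Basis (fst (prod_decode p)))"
  let ?s = "\<lambda>t b. SUP q::rat. if cantor_digit (prod_encode (to_nat_on (Basis::'a set) b, to_nat q)) t
                 then ereal (of_rat q) else -\<infinity>"
  \<comment> \<open>At a real that is not a code a supremum may be infinite;
    \<open>real_of_ereal\<close> then returns 0, which keeps \<open>?k\<close> total.\<close>
  let ?k = "\<lambda>t. \<Sum>b\<in>Basis. real_of_ereal (?s t b) *\<^sub>R b"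
  show "?j \<in> borel_measurable borel"
    by measurable
  show "?k \<in> borel_measurable borel"
    by measurable
  show "?k (?j x) = x" for x
  proof -
    have "?s (?j x) b = ereal (x \<bullet> b)" if "b \<in> Basis" for b
      using that SUP_rat_below[of "x \<bullet> b"] by (simp add: countable_finite)
    then show ?thesis
      by (simp add: euclidean_representation)
  qed
qed

text \<open>The Euclidean retract is composed with \<Phi> on one side and with its inverse on the
  other.\<close>

lemma bimeasurable_injection_real_retract:
  fixes \<Phi> :: "'a \<Rightarrow> 'e::euclidean_space"
  assumes \<Phi>: "bimeasurable_injection X \<Phi>" and ne: "space X \<noteq> {}"
  obtains j k where "j \<in> borel_measurable X" "k \<in> (borel :: real measure) \<rightarrow>\<^sub>M X"
    "\<And>x. x \<in> space X \<Longrightarrow> k (j x) = x"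
proof -
  obtain j :: "'e \<Rightarrow> real" and k where [measurable]: "j \<in> borel_measurable borel" "k \<in> borel_measurable borel"
    and kj: "\<And>x. k (j x) = x"
    by (rule euclidean_space_borel_retract) blast
  obtain x0 where x0: "x0 \<in> space X" using ne by auto
  have [measurable]: "\<Phi> \<in> borel_measurable X" and inj: "inj_on \<Phi> (space X)"
    and inv: "\<And>A. A \<in> sets X \<Longrightarrow> the_inv_into (space X) \<Phi> -` A \<inter> \<Phi> ` space X \<in> sets borel"
    using \<Phi> by (auto simp: bimeasurable_injection_def)
  \<comment> \<open>The image is the domain of the inverse, hence the preimage of the whole
    space.\<close>
  have im[measurable]: "\<Phi> ` space X \<in> sets borel"
  proof -
    have "the_inv_into (space X) \<Phi> -` space X \<inter> \<Phi> ` space X = \<Phi> ` space X"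
      using the_inv_into_f_f[OF inj] by auto
    then show ?thesis using inv[of "space X"] by simp
  qed
  \<comment> \<open>The inverse is extended by a constant off the image; since the image is Borel,
    the extension is measurable on the whole Euclidean space.\<close>
  define g where "g z = (if z \<in> \<Phi> ` space X then the_inv_into (space X) \<Phi> z else x0)" for z
  have [measurable]: "g \<in> borel \<rightarrow>\<^sub>M X"
  proof (rule measurableI)
    show "g z \<in> space X" for z
      using the_inv_into_f_f[OF inj] x0 by (auto simp: g_def)
    fix A assume A: "A \<in> sets X"
    have "g -` A \<inter> space borel = (the_inv_into (space X) \<Phi> -` A \<inter> \<Phi> ` space X) \<union>
      (if x0 \<in> A then - \<Phi> ` space X else {})"
      by (auto simp: g_def split: if_splits)
    then show "g -` A \<inter> space borel \<in> sets borel"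
      using inv[OF A] im by (auto simp: borel_comp)
  qed
  show thesis
  proof
    show "(\<lambda>x. j (\<Phi> x)) \<in> borel_measurable X" "(\<lambda>t. g (k t)) \<in> borel \<rightarrow>\<^sub>M X"
      by measurable
    show "g (k (j (\<Phi> x))) = x" if "x \<in> space X" for x
      using that by (simp add: kj g_def the_inv_into_f_f[OF inj])
  qed
qed

section \<open>Monotone rearrangement\<close>

text \<open>
  The value outside the open unit interval is junk, but it has to be fixed for joint measurability.
\<close>
definition quantile :: "real measure \<Rightarrow> real \<Rightarrow> real" where
  "quantile M s = (if 0 < s \<and> s < 1 then Inf {x. s \<le> cdf M x} else 0)"

text \<open>The Galois connection between quantile and distribution function. It turns sublevel sets
  of quantiles into conditions on \<open>cdf\<close>.\<close>

lemma quantile_le_iff: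
  assumes "real_distribution M" "0 < s" "s < 1"
  shows "quantile M s \<le> x \<longleftrightarrow> s \<le> cdf M x"
proof -
  interpret cdf_distribution M using assms(1) by (simp add: cdf_distribution_def)
  show ?thesis using pseudoinverse[of s x] assms by (simp add: quantile_def)
qed

text \<open>Without atoms the distribution function is continuous. Left of the quantile it stays
  below \<open>s\<close>, so its value there, being the left limit, is at most \<open>s\<close>; the
  Galois connection gives the converse.\<close>

lemma cdf_quantile:
  assumes M: "real_distribution M" and "\<And>x. measure M {x} = 0" and s: "0 < s" "s < 1"
  shows "cdf M (quantile M s) = s"
proof (rule antisym)
  interpret real_distribution M by fact
  let ?q = "quantile M s"
  have "isCont (cdf M) ?q" using assms(2) by (simp add: isCont_cdf)
  then have "(cdf M \<longlongrightarrow> cdf M ?q) (at_left ?q)"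
    by (auto simp: isCont_def intro: tendsto_within_subset)
  then show "cdf M ?q \<le> s"
  proof (rule tendsto_upperbound)
    have "cdf M x \<le> s" if "x < ?q" for x
      using quantile_le_iff[OF M s, of x] that by auto
    then show "\<forall>\<^sub>F x in at_left ?q. cdf M x \<le> s"
      by (simp add: eventually_at_filter)
  qed simp
  show "s \<le> cdf M ?q"
    using quantile_le_iff[OF M s] by auto
qed

text \<open>Inverse transform sampling: on the open unit interval \<open>quantile\<close> is the
  pseudoinverse \<open>I\<close> of Skorohod's construction.\<close>

lemma distr_quantile:
  assumes "real_distribution M"
  shows "distr (restrict_space lborel {0<..<1}) borel (quantile M) = M"
proof -
  interpret cdf_distribution M using assms by (simp add: cdf_distribution_def)
  have "distr (restrict_space lborel {0<..<1}) borel (quantile M) =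
      distr (restrict_space lborel {0<..<1}) borel I"
    by (rule distr_cong) (auto simp: quantile_def space_restrict_space)
  then show ?thesis by (simp add: distr_I_eq_M)
qed

lemma real_distribution_prob_algebra: "M \<in> space (prob_algebra borel) \<Longrightarrow> real_distribution M"
  by (auto simp: space_prob_algebra real_distribution_def real_distribution_axioms_def)

lemma measurable_quantile_kernel:
  assumes K: "K \<in> M \<rightarrow>\<^sub>M prob_algebra borel" and [measurable]: "s \<in> borel_measurable M"
  shows "(\<lambda>x. quantile (K x) (s x)) \<in> borel_measurable M"
  unfolding borel_measurable_iff_le
proof
  fix a
  note K[measurable]
  \<comment> \<open>Outside the open unit interval the quantile is 0, whence the alternative
    \<open>0 \<le> a\<close>.\<close>
  have "quantile (K x) (s x) \<le> a \<longleftrightarrow>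
      (if 0 < s x \<and> s x < 1 then s x \<le> measure (K x) {..a} else 0 \<le> a)"
    if "x \<in> space M" for x
  proof (cases "0 < s x \<and> s x < 1")
    case True
    have "real_distribution (K x)"
      using measurable_space[OF K that] by (rule real_distribution_prob_algebra)
    then show ?thesis
      using True quantile_le_iff[of "K x" "s x" a] by (simp add: cdf_def)
  next
    case False
    show ?thesis unfolding quantile_def if_not_P[OF False] by (rule refl)
  qed
  then have "{x \<in> space M. quantile (K x) (s x) \<le> a} =
    {x \<in> space M. if 0 < s x \<and> s x < 1 then s x \<le> measure (K x) {..a} else 0 \<le> a}"
    by auto
  also have "\<dots> \<in> sets M" by measurable
  finally show "{x \<in> space M. quantile (K x) (s x) \<le> a} \<in> sets M" .
qed

text \<open>The kernel is evaluated on the sections of the measurable set of pairs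
  \<open>(x, r)\<close> with \<open>r \<le> t x\<close>.\<close>

lemma measurable_cdf_kernel:
  assumes K: "K \<in> M \<rightarrow>\<^sub>M prob_algebra borel" and [measurable]: "t \<in> borel_measurable M"
  shows "(\<lambda>x. cdf (K x) (t x)) \<in> borel_measurable M"
  unfolding cdf_def
proof (rule measure_measurable_subprob_algebra2)
  show "K \<in> M \<rightarrow>\<^sub>M subprob_algebra borel" using K by (rule measurable_prob_algebraD)
  have "(SIGMA x:space M. {..t x}) = {p \<in> space (M \<Otimes>\<^sub>M borel). snd p \<le> t (fst p)}"
    by (auto simp: space_pair_measure)
  also have "\<dots> \<in> sets (M \<Otimes>\<^sub>M borel)" by measurable
  finally show "(SIGMA x:space M. {..t x}) \<in> sets (M \<Otimes>\<^sub>M borel)" .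
qed

lemma measurable_quantile:
  assumes "real_distribution M"
  shows "quantile M \<in> borel_measurable borel"
proof -
  interpret real_distribution M by fact
  have "M \<in> space (prob_algebra borel)"
    by (simp add: space_prob_algebra prob_space_axioms)
  then show ?thesis
    using measurable_quantile_kernel[of "\<lambda>_. M" borel "\<lambda>s. s"] by simp
qed

text \<open>Write \<open>M\<close> as the image of the uniform law under its own quantile function;
  \<open>cdf M\<close> cancels it, and the quantile function of \<open>N\<close> acts directly on
  the uniform law.\<close>

lemma distr_quantile_cdf:
  assumes M: "real_distribution M" and N: "real_distribution N" and "\<And>x. measure M {x} = 0"
  shows "distr M borel (\<lambda>x. quantile N (cdf M x)) = N"
proof -
  let ?U = "restrict_space lborel {0<..<1::real}"
  interpret M: cdf_distribution M using M by (simp add: cdf_distribution_def)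
  have [measurable]: "quantile M \<in> borel_measurable borel" "quantile N \<in> borel_measurable borel"
    using M N by (auto intro: measurable_quantile)
  have [measurable]: "quantile M \<in> borel_measurable ?U"
    by (rule measurable_restrict_space1) simp
  have "distr M borel (\<lambda>x. quantile N (cdf M x)) =
      distr (distr ?U borel (quantile M)) borel (\<lambda>x. quantile N (cdf M x))"
    by (simp add: distr_quantile[OF M])
  also have "\<dots> = distr ?U borel (\<lambda>s. quantile N (cdf M (quantile M s)))"
    by (subst distr_distr) (simp_all add: comp_def)
  also have "\<dots> = distr ?U borel (quantile N)"
    by (rule distr_cong) (auto simp: space_restrict_space cdf_quantile[OF M assms(3)])
  finally show ?thesis by (simp add: distr_quantile[OF N])
qed

text \<open>By injectivity the preimage of a point has at most one element. A subset of positive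
  measure is then all of it, so it cannot have smaller measure.\<close>

lemma atomless_distr_singleton:
  assumes "atomless P" and [measurable]: "j \<in> borel_measurable P" and inj: "inj_on j (space P)"
  shows "measure (distr P borel j) {t::real} = 0"
proof -
  let ?A = "j -` {t} \<inter> space P"
  have A: "?A \<in> sets P" by measurable
  have "emeasure P ?A = 0"
  proof (rule ccontr)
    assume "emeasure P ?A \<noteq> 0"
    then obtain B where B: "B \<in> sets P" "B \<subseteq> ?A" "0 < emeasure P B" "emeasure P B < emeasure P ?A"
      using assms(1) A unfolding atomless_def by (metis gr_zeroI)
    then obtain x where "x \<in> B" by fastforce
    then have "?A \<subseteq> B" using B(2) inj by (auto simp: inj_on_def)
    then show False using B by auto
  qed
  then show ?thesis by (simp add: measure_distr) (simp add: measure_def)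
qed


section \<open>Disintegrations\<close>

lemma disintegration_AE_fibre:
  assumes "disintegration \<mu> B \<phi> m"
  shows "AE u in distr \<mu> B \<phi>. AE x in m u. \<phi> x = u"
proof -
  have m: "m \<in> B \<rightarrow>\<^sub>M prob_algebra \<mu>"
    and "AE u in distr \<mu> B \<phi>. space \<mu> - \<phi> -` {u} \<in> null_sets (m u)"
    using assms by (auto simp: disintegration_def)
  from this(2) AE_space show ?thesis
  proof eventually_elim
    fix u assume "u \<in> space (distr \<mu> B \<phi>)" and N: "space \<mu> - \<phi> -` {u} \<in> null_sets (m u)"
    then have "sets (m u) = sets \<mu>"
      using measurable_space[OF m, of u] by (simp add: space_prob_algebra)
    then have "space (m u) = space \<mu>" by (rule sets_eq_imp_space_eq)
    then show "AE x in m u. \<phi> x = u"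
      by (intro AE_I'[OF N]) auto
  qed
qed

lemma disintegration_nn_integral:
  assumes "disintegration \<mu> B \<phi> m" "f \<in> borel_measurable \<mu>"
  shows "(\<integral>\<^sup>+x. f x \<partial>\<mu>) = (\<integral>\<^sup>+u. (\<integral>\<^sup>+x. f x \<partial>m u) \<partial>distr \<mu> B \<phi>)"
proof -
  have "(\<integral>\<^sup>+x. f x \<partial>\<mu>) = (\<integral>\<^sup>+u. (\<integral>\<^sup>+x\<in>\<phi> -` {u}. f x \<partial>m u) \<partial>distr \<mu> B \<phi>)"
    using assms by (simp add: disintegration_def)
  also have "\<dots> = (\<integral>\<^sup>+u. (\<integral>\<^sup>+x. f x \<partial>m u) \<partial>distr \<mu> B \<phi>)"
    using disintegration_AE_fibre[OF assms(1)]
    by (intro nn_integral_cong_AE, eventually_elim) (auto intro!: nn_integral_cong_AE elim!: eventually_mono)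
  finally show ?thesis .
qed

lemma disintegration_emeasure:
  assumes "disintegration \<mu> B \<phi> m" "A \<in> sets \<mu>"
  shows "emeasure \<mu> A = (\<integral>\<^sup>+u. emeasure (m u) A \<partial>distr \<mu> B \<phi>)"
proof -
  have m: "m \<in> B \<rightarrow>\<^sub>M prob_algebra \<mu>" using assms(1) by (simp add: disintegration_def)
  have "emeasure \<mu> A = (\<integral>\<^sup>+u. (\<integral>\<^sup>+x. indicator A x \<partial>m u) \<partial>distr \<mu> B \<phi>)"
    using disintegration_nn_integral[OF assms(1), of "indicator A"] assms(2) by simp
  also have "\<dots> = (\<integral>\<^sup>+u. emeasure (m u) A \<partial>distr \<mu> B \<phi>)"
    using measurable_space[OF m] assms(2)
    by (intro nn_integral_cong nn_integral_indicator) (auto simp: space_prob_algebra)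
  finally show ?thesis .
qed

text \<open>The monotone map of the fibre over \<open>u\<close> is evaluated at
  \<open>u = \<phi> x\<close>. Conditioning on \<phi> gives the joint law of \<phi> and
  \<open>T\<close> on rectangles, from which both the image of \<mu> under \<open>T\<close> and the
  projection onto the base are computed later.\<close>

lemma kernel_transport:
  fixes j :: "'a \<Rightarrow> real" and i :: "'b \<Rightarrow> real"
  assumes dis: "disintegration \<mu> B \<phi> m" and \<phi>: "\<phi> \<in> \<mu> \<rightarrow>\<^sub>M B"
    and al: "AE u in distr \<mu> B \<phi>. atomless (m u)"
    and n: "n \<in> B \<rightarrow>\<^sub>M prob_algebra Y"
    and j: "j \<in> borel_measurable \<mu>" "inj_on j (space \<mu>)"
    and i: "i \<in> borel_measurable Y" and k: "k \<in> borel \<rightarrow>\<^sub>M Y" and ki: "\<And>y. y \<in> space Y \<Longrightarrow> k (i y) = y"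
  obtains T where "T \<in> \<mu> \<rightarrow>\<^sub>M Y"
    "\<And>A C. A \<in> sets B \<Longrightarrow> C \<in> sets Y \<Longrightarrow>
      emeasure \<mu> {x \<in> space \<mu>. \<phi> x \<in> A \<and> T x \<in> C} =
      (\<integral>\<^sup>+u. indicator A u * emeasure (n u) C \<partial>distr \<mu> B \<phi>)"
proof
  note [measurable] = \<phi> j(1) i k
  have m: "m \<in> B \<rightarrow>\<^sub>M prob_algebra \<mu>" using dis by (simp add: disintegration_def)
  define P where "P u = distr (m u) borel j" for u
  define Q where "Q u = distr (n u) borel i" for u
  define S where "S u x = k (quantile (Q u) (cdf (P u) (j x)))" for u x
  let ?T = "\<lambda>x. S (\<phi> x) x"
  have P[measurable]: "P \<in> B \<rightarrow>\<^sub>M prob_algebra borel"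
    unfolding P_def[abs_def] by (rule measurable_compose[OF m measurable_distr_prob_space]) simp
  have Q[measurable]: "Q \<in> B \<rightarrow>\<^sub>M prob_algebra borel"
    unfolding Q_def[abs_def] by (rule measurable_compose[OF n measurable_distr_prob_space]) simp
  \<comment> \<open>The base point is left as a function \<open>h\<close>: \<open>h = \<phi>\<close>
    gives the glued map, a constant \<open>h\<close> gives a single fibre map.\<close>
  have S: "(\<lambda>x. S (h x) x) \<in> \<mu> \<rightarrow>\<^sub>M Y" if [measurable]: "h \<in> \<mu> \<rightarrow>\<^sub>M B" for h
    unfolding S_def
    by (intro measurable_compose[OF _ k] measurable_quantile_kernel measurable_cdf_kernel) measurable
  show T[measurable]: "?T \<in> \<mu> \<rightarrow>\<^sub>M Y" using S[OF \<phi>] .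
  have fibre: "distr (m u) Y (S u) = n u" if u: "u \<in> space B" and "atomless (m u)" for u
  proof -
    have mu: "sets (m u) = sets \<mu>" and nu: "sets (n u) = sets Y"
      using measurable_space[OF m u] measurable_space[OF n u] by (auto simp: space_prob_algebra)
    have [measurable_cong]: "sets (m u) = sets \<mu>" "sets (n u) = sets Y" by fact+
    have RP: "real_distribution (P u)" and RQ: "real_distribution (Q u)"
      using measurable_space[OF P u] measurable_space[OF Q u] by (auto intro: real_distribution_prob_algebra)
    have [measurable]: "quantile (Q u) \<in> borel_measurable borel" using RQ by (rule measurable_quantile)
    have [measurable]: "cdf (P u) \<in> borel_measurable borel"
      using cdf_distribution.measurable_C RP by (auto simp: cdf_distribution_def)
    have "measure (P u) {t} = 0" for t
      unfolding P_def using that(2) j(2) sets_eq_imp_space_eq[OF mu] by (intro atomless_distr_singleton) auto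
    then have PQ: "distr (P u) borel (\<lambda>t. quantile (Q u) (cdf (P u) t)) = Q u"
      using distr_quantile_cdf[OF RP RQ] by simp
    have "distr (m u) Y (S u) = distr (distr (P u) borel (\<lambda>t. quantile (Q u) (cdf (P u) t))) Y k"
    proof -
      have [measurable]: "cdf (distr (m u) borel j) \<in> borel_measurable borel"
        using \<open>cdf (P u) \<in> borel_measurable borel\<close> by (simp add: P_def)
      show ?thesis
        unfolding P_def[of u] S_def[abs_def] by (simp add: distr_distr comp_def)
    qed
    also have "\<dots> = distr (n u) Y (\<lambda>y. k (i y))"
      unfolding PQ unfolding Q_def by (simp add: distr_distr comp_def)
    \<comment> \<open>The target law on the line is the image of \<open>n u\<close> under
      \<open>i\<close>, and \<open>k\<close> undoes \<open>i\<close>.\<close>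
    also have "\<dots> = distr (n u) (n u) (\<lambda>y. y)"
      using ki nu by (intro distr_cong) (auto simp: sets_eq_imp_space_eq[OF nu])
    finally show ?thesis by simp
  qed
  fix A C assume [measurable]: "A \<in> sets B" "C \<in> sets Y"
  let ?E = "{x \<in> space \<mu>. \<phi> x \<in> A \<and> ?T x \<in> C}"
  have "emeasure \<mu> ?E = (\<integral>\<^sup>+u. emeasure (m u) ?E \<partial>distr \<mu> B \<phi>)"
    by (rule disintegration_emeasure[OF dis]) measurable
  also have "\<dots> = (\<integral>\<^sup>+u. indicator A u * emeasure (n u) C \<partial>distr \<mu> B \<phi>)"
  proof (rule nn_integral_cong_AE)
    show "AE u in distr \<mu> B \<phi>. emeasure (m u) ?E = indicator A u * emeasure (n u) C"
      using disintegration_AE_fibre[OF dis] al AE_space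
    proof eventually_elim
      fix u assume \<phi>u: "AE x in m u. \<phi> x = u" and "atomless (m u)" "u \<in> space (distr \<mu> B \<phi>)"
      then have u: "u \<in> space B" and nu: "distr (m u) Y (S u) = n u" using fibre by auto
      have mu[measurable_cong]: "sets (m u) = sets \<mu>"
        using measurable_space[OF m u] by (auto simp: space_prob_algebra)
      note space = sets_eq_imp_space_eq[OF mu]
      have [measurable]: "S u \<in> \<mu> \<rightarrow>\<^sub>M Y" using S[of "\<lambda>_. u"] u by simp
      \<comment> \<open>As \<open>m u\<close> is carried by the fibre over \<open>u\<close>, the
        glued map may be replaced by \<open>S u\<close>.\<close>
      have "emeasure (m u) ?E = emeasure (m u) {x \<in> space \<mu>. u \<in> A \<and> S u x \<in> C}"
        using \<phi>u by (intro emeasure_eq_AE) (auto elim!: eventually_mono)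
      also have "\<dots> = indicator A u * emeasure (distr (m u) Y (S u)) C"
        by (auto simp: emeasure_distr space indicator_def vimage_def Int_def conj_commute)
      finally show "emeasure (m u) ?E = indicator A u * emeasure (n u) C" by (simp add: nu)
    qed
  qed
  finally show "emeasure \<mu> ?E = (\<integral>\<^sup>+u. indicator A u * emeasure (n u) C \<partial>distr \<mu> B \<phi>)" .
qed

section \<open>Costs and couplings\<close>

lemma ext_integral_distr:
  "g \<in> M \<rightarrow>\<^sub>M N \<Longrightarrow> f \<in> borel_measurable N \<Longrightarrow> ext_integral (distr M N g) f = ext_integral M (\<lambda>x. f (g x))"
  by (simp add: ext_integral_def nn_integral_distr)

lemma ext_integral_cong:
  "(\<And>x. x \<in> space M \<Longrightarrow> f x = g x) \<Longrightarrow> ext_integral M f = ext_integral M g"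
  by (simp add: ext_integral_def cong: nn_integral_cong)

lemma graph_in_couplings:
  assumes "prob_space \<mu>" and [measurable]: "T \<in> \<mu> \<rightarrow>\<^sub>M \<nu>" and "distr \<mu> \<nu> T = \<nu>"
  shows "distr \<mu> (\<mu> \<Otimes>\<^sub>M \<nu>) (\<lambda>x. (x, T x)) \<in> couplings \<mu> \<nu>"
  using assms by (auto simp: couplings_def space_prob_algebra distr_distr comp_def intro!: prob_space.prob_space_distr)

text \<open>Each coordinate projection commutes with the product map. Competitors of the constructed
  plan thereby become competitors of the plan of \<open>tB\<close>.\<close>

lemma distr_in_couplings:
  assumes \<pi>: "\<pi> \<in> couplings \<mu> \<nu>" and [measurable]: "\<phi> \<in> \<mu> \<rightarrow>\<^sub>M BX" "\<psi> \<in> \<nu> \<rightarrow>\<^sub>M BY"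
  shows "distr \<pi> (distr \<mu> BX \<phi> \<Otimes>\<^sub>M distr \<nu> BY \<psi>) (\<lambda>(x, y). (\<phi> x, \<psi> y))
    \<in> couplings (distr \<mu> BX \<phi>) (distr \<nu> BY \<psi>)"
proof -
  have [measurable_cong]: "sets \<pi> = sets (\<mu> \<Otimes>\<^sub>M \<nu>)" and p: "prob_space \<pi>"
    and fst: "distr \<pi> \<mu> fst = \<mu>" and snd: "distr \<pi> \<nu> snd = \<nu>"
    using \<pi> by (auto simp: couplings_def space_prob_algebra)
  let ?P = "distr \<mu> BX \<phi> \<Otimes>\<^sub>M distr \<nu> BY \<psi>"
  let ?D = "distr \<pi> ?P (\<lambda>(x, y). (\<phi> x, \<psi> y))"
  have "distr ?D (distr \<mu> BX \<phi>) fst = distr \<pi> BX (\<lambda>p. \<phi> (fst p))"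
    by (subst distr_distr) (auto intro!: distr_cong)
  also have "\<dots> = distr (distr \<pi> \<mu> fst) BX \<phi>"
    by (subst distr_distr) (auto simp: comp_def)
  finally have 1: "distr ?D (distr \<mu> BX \<phi>) fst = distr \<mu> BX \<phi>" by (simp add: fst)
  have "distr ?D (distr \<nu> BY \<psi>) snd = distr \<pi> BY (\<lambda>p. \<psi> (snd p))"
    by (subst distr_distr) (auto intro!: distr_cong)
  also have "\<dots> = distr (distr \<pi> \<nu> snd) BY \<psi>"
    by (subst distr_distr) (auto simp: comp_def)
  finally have 2: "distr ?D (distr \<nu> BY \<psi>) snd = distr \<nu> BY \<psi>" by (simp add: snd)
  have "prob_space ?D"
    by (intro prob_space.prob_space_distr[OF p]) measurable
  then show ?thesis
    using 1 2 by (simp add: couplings_def space_prob_algebra)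
qed

text \<open>Rectangles form an intersection-stable generator, and finiteness on the whole space
  gives uniqueness.\<close>

lemma distr_pair_eqI:
  assumes M: "finite_measure M"
    and [measurable]: "f \<in> M \<rightarrow>\<^sub>M A" "f' \<in> M \<rightarrow>\<^sub>M A" "g \<in> M \<rightarrow>\<^sub>M B" "g' \<in> M \<rightarrow>\<^sub>M B"
    and eq: "\<And>a b. a \<in> sets A \<Longrightarrow> b \<in> sets B \<Longrightarrow>
      emeasure M {x \<in> space M. f x \<in> a \<and> g x \<in> b} = emeasure M {x \<in> space M. f' x \<in> a \<and> g' x \<in> b}"
  shows "distr M (A \<Otimes>\<^sub>M B) (\<lambda>x. (f x, g x)) = distr M (A \<Otimes>\<^sub>M B) (\<lambda>x. (f' x, g' x))" (is "?L = ?R")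
proof (rule measure_eqI_generator_eq[OF Int_stable_pair_measure_generator pair_measure_closed])
  fix X assume "X \<in> {a \<times> b |a b. a \<in> sets A \<and> b \<in> sets B}"
  then obtain a b where X: "X = a \<times> b" and [measurable]: "a \<in> sets A" "b \<in> sets B" by auto
  show "emeasure ?L X = emeasure ?R X"
    using eq[of a b] by (simp add: X emeasure_distr vimage_def Int_def conj_commute)
next
  show "sets ?L = sigma_sets (space A \<times> space B) {a \<times> b |a b. a \<in> sets A \<and> b \<in> sets B}"
    by (simp only: sets_distr sets_pair_measure)
  show "sets ?R = sigma_sets (space A \<times> space B) {a \<times> b |a b. a \<in> sets A \<and> b \<in> sets B}"
    by (simp only: sets_distr sets_pair_measure)
  show "range (\<lambda>_::nat. space A \<times> space B) \<subseteq> {a \<times> b |a b. a \<in> sets A \<and> b \<in> sets B}"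
    by blast
  show "emeasure ?L (space A \<times> space B) \<noteq> \<infinity>"
    using finite_measure.emeasure_finite[OF finite_measure.finite_measure_distr[OF M], of "\<lambda>x. (f x, g x)"]
    by (simp add: infinity_ennreal_def)
qed simp

theorem theorem2p1:
  fixes X :: "'a measure" and Y :: "'b measure"
    and BX :: "'u measure" and BY :: "'v measure"
    and \<Phi>X :: "'a \<Rightarrow> real ^ 'd" and \<Phi>Y :: "'b \<Rightarrow> real ^ 'd"
    and \<mu> :: "'a measure" and \<nu> :: "'b measure"
    and c :: "'a \<times> 'b \<Rightarrow> real" and c' :: "'u \<times> 'v \<Rightarrow> real"
    and \<phi> :: "'a \<Rightarrow> 'u" and \<psi> :: "'b \<Rightarrow> 'v" and tB :: "'u \<Rightarrow> 'v"
    and \<mu>d :: "'u \<Rightarrow> 'a measure" and \<nu>d :: "'v \<Rightarrow> 'b measure"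
  assumes "bimeasurable_injection X \<Phi>X" and "bimeasurable_injection Y \<Phi>Y"
    and "\<mu> \<in> space (prob_algebra X)" and "\<nu> \<in> space (prob_algebra Y)"
    and "\<phi> \<in> X \<rightarrow>\<^sub>M BX" and "\<psi> \<in> Y \<rightarrow>\<^sub>M BY"
    and "transport_cost \<mu> \<nu> c"
    and "transport_cost (distr \<mu> BX \<phi>) (distr \<nu> BY \<psi>) c'"
    and "\<And>x y. x \<in> space X \<Longrightarrow> y \<in> space Y \<Longrightarrow> c (x, y) = c' (\<phi> x, \<psi> y)"
    and "Monge_map (distr \<mu> BX \<phi>) (distr \<nu> BY \<psi>) c' tB"
    and "disintegration \<mu> BX \<phi> \<mu>d"
    and "AE u in distr \<mu> BX \<phi>. atomless (\<mu>d u)"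
    and "disintegration \<nu> BY \<psi> \<nu>d"
  shows "\<exists>T. Monge_map \<mu> \<nu> c T \<and>
           distr (distr \<mu> (X \<Otimes>\<^sub>M Y) (\<lambda>x. (x, T x))) (BX \<Otimes>\<^sub>M BY) (\<lambda>(x, y). (\<phi> x, \<psi> y)) =
           distr (distr \<mu> BX \<phi>) (BX \<Otimes>\<^sub>M BY) (\<lambda>u. (u, tB u))"
proof -

  \<comment> \<open>Gluing the fibre maps\<close>
  note inj = assms(1,2) and \<phi>X = assms(5) and \<psi>Y = assms(6) and cost' = assms(8)
    and c = assms(9) and tB = assms(10) and dis = assms(11) and al = assms(12) and dis' = assms(13)
  have sX[measurable_cong]: "sets \<mu> = sets X" and sY[measurable_cong]: "sets \<nu> = sets Y"
    and p\<mu>: "prob_space \<mu>" and p\<nu>: "prob_space \<nu>"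
    using assms(3,4) by (auto simp: space_prob_algebra)
  interpret \<mu>: prob_space \<mu> by fact
  interpret \<nu>: prob_space \<nu> by fact
  note spX = sets_eq_imp_space_eq[OF sX] and spY = sets_eq_imp_space_eq[OF sY]
  let ?\<mu>B = "distr \<mu> BX \<phi>" and ?\<nu>B = "distr \<nu> BY \<psi>"
  have \<phi>[measurable]: "\<phi> \<in> \<mu> \<rightarrow>\<^sub>M BX" and \<psi>[measurable]: "\<psi> \<in> \<nu> \<rightarrow>\<^sub>M BY"
    using \<phi>X \<psi>Y sX sY by (auto cong: measurable_cong_sets)
  have tB_meas[measurable]: "tB \<in> BX \<rightarrow>\<^sub>M BY" and tB_push: "distr ?\<mu>B ?\<nu>B tB = ?\<nu>B"
    and tB_opt: "is_arg_min (\<lambda>\<pi>. ext_integral \<pi> c') (\<lambda>\<pi>. \<pi> \<in> couplings ?\<mu>B ?\<nu>B)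
        (distr ?\<mu>B (?\<mu>B \<Otimes>\<^sub>M ?\<nu>B) (\<lambda>u. (u, tB u)))"
    using tB by (auto simp: Monge_map_def)
  have tB_push': "distr ?\<mu>B BY tB = ?\<nu>B"
    using tB_push by (simp cong: distr_cong)
  have n': "\<nu>d \<in> BY \<rightarrow>\<^sub>M prob_algebra \<nu>"
    using dis' by (simp add: disintegration_def)
  \<comment> \<open>The target over \<open>u\<close> is the fibre measure of \<nu> at
    \<open>tB u\<close>.\<close>
  then have n: "(\<lambda>u. \<nu>d (tB u)) \<in> BX \<rightarrow>\<^sub>M prob_algebra \<nu>"
    by measurable
  have \<nu>d_meas: "(\<lambda>v. emeasure (\<nu>d v) C) \<in> borel_measurable BY" if "C \<in> sets \<nu>" for C
    using measurable_compose[OF measurable_prob_algebraD[OF n'] measurable_emeasure_subprob_algebra[OF that]] .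
  obtain jX :: "'a \<Rightarrow> real" and kX where jX: "jX \<in> borel_measurable X" "\<And>x. x \<in> space X \<Longrightarrow> kX (jX x) = x"
    using bimeasurable_injection_real_retract[OF inj(1)] \<mu>.not_empty spX by metis
  obtain jY :: "'b \<Rightarrow> real" and kY where jY: "jY \<in> borel_measurable Y" "kY \<in> borel \<rightarrow>\<^sub>M Y"
      "\<And>y. y \<in> space Y \<Longrightarrow> kY (jY y) = y"
    using bimeasurable_injection_real_retract[OF inj(2)] \<nu>.not_empty spY by metis
  have "jX \<in> borel_measurable \<mu>" "inj_on jX (space \<mu>)" "jY \<in> borel_measurable \<nu>" "kY \<in> borel \<rightarrow>\<^sub>M \<nu>"
      "\<And>y. y \<in> space \<nu> \<Longrightarrow> kY (jY y) = y"
    using jX jY sX sY spX spY by (auto cong: measurable_cong_sets intro: inj_on_inverseI)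
  from kernel_transport[OF dis \<phi> al n this]
  obtain T where T[measurable]: "T \<in> \<mu> \<rightarrow>\<^sub>M \<nu>"
    and law: "\<And>A C. A \<in> sets BX \<Longrightarrow> C \<in> sets \<nu> \<Longrightarrow>
      emeasure \<mu> {x \<in> space \<mu>. \<phi> x \<in> A \<and> T x \<in> C} = (\<integral>\<^sup>+u. indicator A u * emeasure (\<nu>d (tB u)) C \<partial>?\<mu>B)"
    by blast

  \<comment> \<open>Taking the whole base for \<open>A\<close>, the base integral moves along
    \<open>tB\<close> to the image of \<nu> under \<psi>, where the disintegration of \<nu>
    reassembles \<open>C\<close>.\<close>
  have push: "distr \<mu> \<nu> T = \<nu>"
  proof (rule measure_eqI)
    fix C assume "C \<in> sets (distr \<mu> \<nu> T)"
    then have C[measurable]: "C \<in> sets \<nu>" by simp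
    have "emeasure (distr \<mu> \<nu> T) C = emeasure \<mu> {x \<in> space \<mu>. \<phi> x \<in> space BX \<and> T x \<in> C}"
      using measurable_space[OF \<phi>] by (auto simp: emeasure_distr intro!: arg_cong[where f="emeasure \<mu>"])
    also have "\<dots> = (\<integral>\<^sup>+u. emeasure (\<nu>d (tB u)) C \<partial>?\<mu>B)"
      unfolding law[OF sets.top C] by (rule nn_integral_cong) simp
    also have "\<dots> = (\<integral>\<^sup>+v. emeasure (\<nu>d v) C \<partial>distr ?\<mu>B BY tB)"
      by (rule nn_integral_distr[symmetric]) (simp_all add: \<nu>d_meas[OF C])
    also have "\<dots> = emeasure \<nu> C"
      unfolding tB_push' by (rule disintegration_emeasure[OF dis' C, symmetric])
    finally show "emeasure (distr \<mu> \<nu> T) C = emeasure \<nu> C" .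
  qed simp

  \<comment> \<open>The diagonal of \<open>BY\<close> need not be measurable, so the two laws are compared on rectangles
    rather than through \<open>\<psi> (T x) = tB (\<phi> x)\<close> almost everywhere.\<close>
  have proj: "distr \<mu> (BX \<Otimes>\<^sub>M BY) (\<lambda>x. (\<phi> x, \<psi> (T x))) = distr \<mu> (BX \<Otimes>\<^sub>M BY) (\<lambda>x. (\<phi> x, tB (\<phi> x)))"
  proof (rule distr_pair_eqI)
    fix A C assume A[measurable]: "A \<in> sets BX" and C[measurable]: "C \<in> sets BY"
    have C': "\<psi> -` C \<inter> space \<nu> \<in> sets \<nu>" by measurable
    \<comment> \<open>Almost every fibre measure sees \<psi> as the constant \<open>v\<close>, so
      this mass is 0 or 1.\<close>
    have "AE v in ?\<nu>B. emeasure (\<nu>d v) (\<psi> -` C \<inter> space \<nu>) = indicator C v"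
      using disintegration_AE_fibre[OF dis'] AE_space
    proof eventually_elim
      fix v assume v: "AE y in \<nu>d v. \<psi> y = v" "v \<in> space ?\<nu>B"
      have sv: "sets (\<nu>d v) = sets \<nu>" and "prob_space (\<nu>d v)"
        using measurable_space[OF n', of v] v(2) by (auto simp: space_prob_algebra)
      then interpret P: prob_space "\<nu>d v" by simp
      have "emeasure (\<nu>d v) (\<psi> -` C \<inter> space \<nu>) = emeasure (\<nu>d v) (if v \<in> C then space \<nu> else {})"
        using v(1) C' sv by (intro emeasure_eq_AE) (auto elim!: eventually_mono)
      then show "emeasure (\<nu>d v) (\<psi> -` C \<inter> space \<nu>) = indicator C v"
        using P.emeasure_space_1 sets_eq_imp_space_eq[OF sv] by (auto simp: indicator_def)
    qed
    \<comment> \<open>Almost sure statements pull back along \<open>tB\<close> because it pushes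
      \<open>?\<mu>B\<close> to \<open>?\<nu>B\<close>.\<close>
    then have "AE u in ?\<mu>B. emeasure (\<nu>d (tB u)) (\<psi> -` C \<inter> space \<nu>) = indicator C (tB u)"
      unfolding tB_push'[symmetric] using \<nu>d_meas[OF C'] by (subst (asm) AE_distr_iff) auto
    then have "(\<integral>\<^sup>+u. indicator A u * emeasure (\<nu>d (tB u)) (\<psi> -` C \<inter> space \<nu>) \<partial>?\<mu>B) =
        (\<integral>\<^sup>+u. indicator (A \<inter> (tB -` C \<inter> space BX)) u \<partial>?\<mu>B)"
      using AE_space by (intro nn_integral_cong_AE, eventually_elim) (auto simp: indicator_def)
    also have "\<dots> = emeasure \<mu> {x \<in> space \<mu>. \<phi> x \<in> A \<and> tB (\<phi> x) \<in> C}"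
      using measurable_space[OF \<phi>]
      by (subst nn_integral_indicator) (auto simp: emeasure_distr intro!: arg_cong[where f="emeasure \<mu>"])
    finally show "emeasure \<mu> {x \<in> space \<mu>. \<phi> x \<in> A \<and> \<psi> (T x) \<in> C} =
        emeasure \<mu> {x \<in> space \<mu>. \<phi> x \<in> A \<and> tB (\<phi> x) \<in> C}"
      unfolding law[OF A C', symmetric] using measurable_space[OF T]
      by (auto intro!: arg_cong[where f="emeasure \<mu>"] simp: conj_commute cong: conj_cong)
  qed (simp_all add: \<mu>.finite_measure_axioms)

  \<comment> \<open>Transfer of optimality from the base\<close>
  let ?PB = "?\<mu>B \<Otimes>\<^sub>M ?\<nu>B"
  let ?\<gamma> = "distr \<mu> (\<mu> \<Otimes>\<^sub>M \<nu>) (\<lambda>x. (x, T x))"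
  have sPB: "sets ?PB = sets (BX \<Otimes>\<^sub>M BY)" by (rule sets_pair_measure_cong) simp_all
  have c'[measurable]: "c' \<in> borel_measurable (BX \<Otimes>\<^sub>M BY)"
    using cost' sPB by (simp add: transport_cost_def cong: measurable_cong_sets)
  have pp[measurable]: "(\<lambda>(x, y). (\<phi> x, \<psi> y)) \<in> \<mu> \<Otimes>\<^sub>M \<nu> \<rightarrow>\<^sub>M BX \<Otimes>\<^sub>M BY"
    by measurable
  \<comment> \<open>Change of variables, since \<open>c\<close> factors through (\<phi>, \<psi>) on
    the product space.\<close>
  have push_cost: "ext_integral \<pi> c = ext_integral (distr \<pi> ?PB (\<lambda>(x, y). (\<phi> x, \<psi> y))) c'"
    if "\<pi> \<in> couplings \<mu> \<nu>" for \<pi>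
  proof -
    have s[measurable_cong]: "sets \<pi> = sets (\<mu> \<Otimes>\<^sub>M \<nu>)"
      using that by (simp add: couplings_def space_prob_algebra)
    have "ext_integral (distr \<pi> ?PB (\<lambda>(x, y). (\<phi> x, \<psi> y))) c' =
        ext_integral \<pi> (\<lambda>p. c' (case p of (x, y) \<Rightarrow> (\<phi> x, \<psi> y)))"
      by (rule ext_integral_distr) simp_all
    also have "\<dots> = ext_integral \<pi> c"
      using c by (intro ext_integral_cong)
        (auto simp: sets_eq_imp_space_eq[OF s] space_pair_measure spX spY)
    finally show ?thesis ..
  qed
  have \<gamma>: "?\<gamma> \<in> couplings \<mu> \<nu>"
    using p\<mu> T push by (rule graph_in_couplings)
  have \<gamma>B: "distr ?\<gamma> ?PB (\<lambda>(x, y). (\<phi> x, \<psi> y)) = distr ?\<mu>B ?PB (\<lambda>u. (u, tB u))"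
  proof -
    have "distr ?\<gamma> ?PB (\<lambda>(x, y). (\<phi> x, \<psi> y)) = distr \<mu> (BX \<Otimes>\<^sub>M BY) (\<lambda>x. (\<phi> x, \<psi> (T x)))"
      by (subst distr_distr) (auto simp: comp_def sPB intro!: distr_cong)
    also have "\<dots> = distr ?\<mu>B ?PB (\<lambda>u. (u, tB u))"
      unfolding proj by (subst distr_distr) (auto simp: comp_def sPB intro!: distr_cong)
    finally show ?thesis .
  qed
  \<comment> \<open>A coupling cheaper than \<open>?\<gamma>\<close> would descend to one cheaper
    than the graph of \<open>tB\<close>, at unchanged costs.\<close>
  have "is_arg_min (\<lambda>\<pi>. ext_integral \<pi> c) (\<lambda>\<pi>. \<pi> \<in> couplings \<mu> \<nu>) ?\<gamma>"
    using tB_opt distr_in_couplings[OF _ \<phi> \<psi>] \<gamma> by (auto simp: is_arg_min_def push_cost \<gamma>B)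
  then have "Monge_map \<mu> \<nu> c T"
    using T push by (simp add: Monge_map_def)
  moreover have "distr (distr \<mu> (X \<Otimes>\<^sub>M Y) (\<lambda>x. (x, T x))) (BX \<Otimes>\<^sub>M BY) (\<lambda>(x, y). (\<phi> x, \<psi> y)) =
      distr ?\<mu>B (BX \<Otimes>\<^sub>M BY) (\<lambda>u. (u, tB u))"
  proof -
    have "distr (distr \<mu> (X \<Otimes>\<^sub>M Y) (\<lambda>x. (x, T x))) (BX \<Otimes>\<^sub>M BY) (\<lambda>(x, y). (\<phi> x, \<psi> y)) =
        distr ?\<gamma> ?PB (\<lambda>(x, y). (\<phi> x, \<psi> y))"
      using sX sY by (intro distr_cong) (simp_all add: sPB cong: sets_pair_measure_cong)
    also have "\<dots> = distr ?\<mu>B (BX \<Otimes>\<^sub>M BY) (\<lambda>u. (u, tB u))"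
      unfolding \<gamma>B by (rule distr_cong) (simp_all add: sPB)
    finally show ?thesis .
  qed
  ultimately show ?thesis by blast
qed

end
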